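(* Let $M,N,K$ be positive integers, $\mathbf A\in\mathbb R^{M\times N}$ with $\mathbf A\ne\mathbf 0$, $\lambda>0$, $\lambda_1>0$, $c_1=3$, $c_2=\|\mathbf A\|_F$, $t_0=\lambda\lambda_1$. On $\mathbb R^{M\times K}\times\mathbb R^{K\times N}$ let $g(\mathbf U,\mathbf Z)=\frac12\|\mathbf A-\mathbf U\mathbf Z\|_F^2$, $f(\mathbf U,\mathbf Z)=\lambda_1(\|\mathbf U\|_1+\|\mathbf Z\|_1)+\mathbf I_{\mathbf U\ge\mathbf 0}+\mathbf I_{\mathbf Z\ge\mathbf 0}$, and $$h(\mathbf U,\mathbf Z)=c_1\Big(\tfrac{\|\mathbf U\|_F^2+\|\mathbf Z\|_F^2}{2}\Big)^2+c_2\,\tfrac{\|\mathbf U\|_F^2+\|\mathbf Z\|_F^2}{2}.$$ Then the BPG-MF update $(\mathbf U^{k+1},\mathbf Z^{k+1})$ from $(\mathbf U^k,\mathbf Z^k)$ is given by $$\mathbf U^{k+1}=r\,\Pi_+\big(-(\mathbf P^k+t_0\mathbf e_M\mathbf e_K^T)\big),\qquad \mathbf Z^{k+1}=r\,\Pi_+\big(-(\mathbf Q^k+t_0\mathbf e_K\mathbf e_N^T)\big),$$ where $r\ge 0$ satisfies $$c_1\Big(\big\|\Pi_+\big(-(\mathbf P^k+t_0\mathbf e_M\mathbf e_K^T)\big)\big\|_F^2+\big\|\Pi_+\big(-(\mathbf Q^k+t_0\mathbf e_K\mathbf e_N^T)\big)\big\|_F^2\Big)r^3+c_2r-1=0 .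$$
   Context: $\|\cdot\|_F$ and $\langle\cdot,\cdot\rangle$ are the Frobenius norm and inner product; $\|\mathbf X\|_1=\sum_{i,j}|\mathbf X_{ij}|$; $\mathbf e_D\in\mathbb R^D$ is the all-ones vector. $\mathbf I_{\mathbf X\ge\mathbf 0}$ is the indicator function equal to $0$ if all entries of $\mathbf X$ are non-negative and $+\infty$ otherwise. $\Pi_+(\cdot)=\max\{0,\cdot\}$ applied entrywise. BPG-MF update: given $\lambda>0$, functions $f,g,h$ on $\mathbb R^{M\times K}\times\mathbb R^{K\times N}$ with $g,h$ differentiable, and a current iterate $(\mathbf U^k,\mathbf Z^k)\in\mathbb R^{M\times K}\times\mathbb R^{K\times N}$, put $\mathbf P^k=\lambda\nabla_{\mathbf U}g(\mathbf U^k,\mathbf Z^k)-\nabla_{\mathbf U}h(\mathbf U^k,\mathbf Z^k)$ and $\mathbf Q^k=\lambda\nabla_{\mathbf Z}g(\mathbf U^k,\mathbf Z^k)-\nabla_{\mathbf Z}h(\mathbf U^k,\mathbf Z^k)$; the update is $$(\mathbf U^{k+1},\mathbf Z^{k+1})\in\operatorname*{argmin}_{(\mathbf U,\mathbf Z)\in\mathbb R^{M\times K}\times\mathbb R^{K\times N}}\{\lambda f(\mathbf U,\mathbf Z)+\langle\mathbf P^k,\mathbf U\rangle+\langle\mathbf Q^k,\mathbf Z\rangle+h(\mathbf U,\mathbf Z)\}.$$ *)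

theory Defs
  imports "HOL-Analysis.Analysis"
begin

(* An M x K matrix is a value of type real^'k^'m, with entries X $ i $ j.  On this type norm and
   inner (written \<bullet>) are the Frobenius norm and inner product.  The all-ones vector is 1 :: real^'d. *)

definition norm_l1 :: "real^'n^'m \<Rightarrow> real" where
  "norm_l1 X = (\<Sum>i\<in>UNIV. \<Sum>j\<in>UNIV. \<bar>X $ i $ j\<bar>)"

definition nonneg_indicator :: "real^'n^'m \<Rightarrow> ereal" where
  "nonneg_indicator X = (if \<forall>i j. 0 \<le> X $ i $ j then 0 else \<infinity>)"

definition pos_part :: "real^'n^'m \<Rightarrow> real^'n^'m" ("\<Pi>\<^sub>+") where
  "\<Pi>\<^sub>+ X = (\<chi> i j. max 0 (X $ i $ j))"

definition outer :: "real^'m \<Rightarrow> real^'n \<Rightarrow> real^'n^'m" where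
  "outer x y = (columnvector x :: real^1^'m) ** (rowvector y :: real^'n^1)"

(* Meaningful only where F is differentiable at x; the gradient is then unique. *)
definition grad :: "('a::real_inner \<Rightarrow> real) \<Rightarrow> 'a \<Rightarrow> 'a" where
  "grad F x = (THE D. GDERIV F x :> D)"

definition grad_fst :: "('a::real_inner \<times> 'b \<Rightarrow> real) \<Rightarrow> 'a \<times> 'b \<Rightarrow> 'a" where
  "grad_fst F = (\<lambda>(u, z). grad (\<lambda>u'. F (u', z)) u)"

definition grad_snd :: "('a \<times> 'b::real_inner \<Rightarrow> real) \<Rightarrow> 'a \<times> 'b \<Rightarrow> 'b" where
  "grad_snd F = (\<lambda>(u, z). grad (\<lambda>z'. F (u, z')) z)"

definition bpg_P ::
  "real \<Rightarrow> ((real^'k^'m) \<times> (real^'n^'k) \<Rightarrow> real) \<Rightarrow> ((real^'k^'m) \<times> (real^'n^'k) \<Rightarrow> real)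
    \<Rightarrow> (real^'k^'m) \<times> (real^'n^'k) \<Rightarrow> real^'k^'m" where
  "bpg_P lam g h x = lam *\<^sub>R grad_fst g x - grad_fst h x"

definition bpg_Q ::
  "real \<Rightarrow> ((real^'k^'m) \<times> (real^'n^'k) \<Rightarrow> real) \<Rightarrow> ((real^'k^'m) \<times> (real^'n^'k) \<Rightarrow> real)
    \<Rightarrow> (real^'k^'m) \<times> (real^'n^'k) \<Rightarrow> real^'n^'k" where
  "bpg_Q lam g h x = lam *\<^sub>R grad_snd g x - grad_snd h x"

definition bpg_objective ::
  "real \<Rightarrow> ((real^'k^'m) \<times> (real^'n^'k) \<Rightarrow> ereal) \<Rightarrow> ((real^'k^'m) \<times> (real^'n^'k) \<Rightarrow> real)
    \<Rightarrow> ((real^'k^'m) \<times> (real^'n^'k) \<Rightarrow> real) \<Rightarrow> (real^'k^'m) \<times> (real^'n^'k)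
    \<Rightarrow> (real^'k^'m) \<times> (real^'n^'k) \<Rightarrow> ereal" where
  "bpg_objective lam f g h x = (\<lambda>(U, Z).
     ereal lam * f (U, Z) + ereal (bpg_P lam g h x \<bullet> U + bpg_Q lam g h x \<bullet> Z + h (U, Z)))"

(* The full set of minimizers, i.e. of admissible next iterates from the current iterate x. *)
definition bpg_mf_update ::
  "real \<Rightarrow> ((real^'k^'m) \<times> (real^'n^'k) \<Rightarrow> ereal) \<Rightarrow> ((real^'k^'m) \<times> (real^'n^'k) \<Rightarrow> real)
    \<Rightarrow> ((real^'k^'m) \<times> (real^'n^'k) \<Rightarrow> real) \<Rightarrow> (real^'k^'m) \<times> (real^'n^'k)
    \<Rightarrow> ((real^'k^'m) \<times> (real^'n^'k)) set" where
  "bpg_mf_update lam f g h x = {y. is_arg_min (bpg_objective lam f g h x) (\<lambda>_. True) y}"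

definition mf_loss :: "real^'n^'m \<Rightarrow> (real^'k^'m) \<times> (real^'n^'k) \<Rightarrow> real" where
  "mf_loss A = (\<lambda>(U, Z). 1 / 2 * (norm (A - U ** Z))\<^sup>2)"

definition l1_nonneg_reg :: "real \<Rightarrow> (real^'k^'m) \<times> (real^'n^'k) \<Rightarrow> ereal" where
  "l1_nonneg_reg lam\<^sub>1 = (\<lambda>(U, Z).
     ereal (lam\<^sub>1 * (norm_l1 U + norm_l1 Z)) + nonneg_indicator U + nonneg_indicator Z)"

definition mf_kernel :: "real \<Rightarrow> real \<Rightarrow> (real^'k^'m) \<times> (real^'n^'k) \<Rightarrow> real" where
  "mf_kernel c\<^sub>1 c\<^sub>2 = (\<lambda>(U, Z).
     c\<^sub>1 * (((norm U)\<^sup>2 + (norm Z)\<^sup>2) / 2)\<^sup>2 + c\<^sub>2 * (((norm U)\<^sup>2 + (norm Z)\<^sup>2) / 2))"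

end

theory Submission
  imports Defs
begin

text \<open>
  Write \<open>x = (U, Z)\<close> for a point of the product space, whose norm satisfies
  \<open>\<parallel>x\<parallel>\<^sup>2 = \<parallel>U\<parallel>\<^sup>2 + \<parallel>Z\<parallel>\<^sup>2\<close>. On the non-negative orthant the \<open>\<ell>\<^sub>1\<close> norm is linear, namely the inner
  product with the all-ones matrix, so there the objective of the update is
  \<open>c\<^sub>1 (\<parallel>x\<parallel>\<^sup>2/2)\<^sup>2 + c\<^sub>2 \<parallel>x\<parallel>\<^sup>2/2 - b \<bullet> x\<close> with \<open>b = - (P + t\<^sub>0 e e\<^sup>T, Q + t\<^sub>0 e e\<^sup>T)\<close>; elsewhere it is \<open>\<infinity>\<close>.

  Two steps remove the constraint and the need for compactness or subdifferentials. Put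
  \<open>v = \<Pi>\<^sub>+ b = (V, W)\<close>. For \<open>x \<ge> 0\<close> one has \<open>b \<bullet> x \<le> v \<bullet> x\<close>, with equality at every multiple of \<open>v\<close>, so
  replacing \<open>b\<close> by \<open>v\<close> only lowers the objective and does not change it at the candidate
  \<open>y = r v\<close>. The new function is smooth and convex on the whole space, with gradient
  \<open>(c\<^sub>1 \<parallel>x\<parallel>\<^sup>2 + c\<^sub>2) x - v\<close>; at \<open>y = r v\<close> this gradient vanishes because of the cubic equation for \<open>r\<close>.
  An exact formula for the excess over the value at such a critical point
  (\<open>quartic_excess_at_critical_point\<close>) bounds it below by \<open>c\<^sub>2 \<parallel>x - y\<parallel>\<^sup>2/2\<close>, which is positive for
  \<open>x \<noteq> y\<close> as \<open>c\<^sub>2 = \<parallel>A\<parallel> > 0\<close>. Hence \<open>y\<close>, which lies in the orthant, is the only minimizer.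
\<close>

lemma cubic_has_nonneg_root:
  fixes a c :: real
  assumes "a \<ge> 0" "c > 0"
  shows "\<exists>r\<ge>0. a * r ^ 3 + c * r - 1 = 0"
proof -
  \<comment> \<open>at \<open>1 / c\<close> the linear term alone already balances the constant\<close>
  have "\<exists>r\<ge>0. r \<le> 1 / c \<and> a * r ^ 3 + c * r - 1 = 0"
    using assms by (intro IVT') (auto intro!: continuous_intros)
  then show ?thesis by blast
qed

text \<open>
  With \<open>s = \<parallel>x\<parallel>\<^sup>2\<close> the function is a quadratic polynomial in \<open>s\<close> minus \<open>v \<bullet> x\<close>, and the hypothesis says
  that its gradient vanishes at \<open>y\<close>. The first summand of the excess is the second-order remainder of
  that polynomial; the second collects what is left of the linear term through
  \<open>2 y \<bullet> (x - y) = \<parallel>x\<parallel>\<^sup>2 - \<parallel>y\<parallel>\<^sup>2 - \<parallel>x - y\<parallel>\<^sup>2\<close>.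
\<close>

lemma quartic_excess_at_critical_point:
  fixes v x y :: "'a::real_inner"
  assumes "v = (c\<^sub>1 * (norm y)\<^sup>2 + c\<^sub>2) *\<^sub>R y"
  shows "(c\<^sub>1 * ((norm x)\<^sup>2 / 2)\<^sup>2 + c\<^sub>2 * ((norm x)\<^sup>2 / 2) - v \<bullet> x)
       - (c\<^sub>1 * ((norm y)\<^sup>2 / 2)\<^sup>2 + c\<^sub>2 * ((norm y)\<^sup>2 / 2) - v \<bullet> y)
       = c\<^sub>1 / 4 * ((norm x)\<^sup>2 - (norm y)\<^sup>2)\<^sup>2 + (c\<^sub>1 * (norm y)\<^sup>2 + c\<^sub>2) / 2 * (norm (x - y))\<^sup>2"
proof -
  have dist: "(norm (x - y))\<^sup>2 = (norm x)\<^sup>2 + (norm y)\<^sup>2 - 2 * (y \<bullet> x)"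
    by (simp add: power2_norm_eq_inner inner_diff inner_commute)
  have inner: "v \<bullet> x = (c\<^sub>1 * (norm y)\<^sup>2 + c\<^sub>2) * (y \<bullet> x)"
    "v \<bullet> y = (c\<^sub>1 * (norm y)\<^sup>2 + c\<^sub>2) * (norm y)\<^sup>2"
    unfolding assms by (simp_all add: power2_norm_eq_inner)
  show ?thesis
    unfolding dist inner by (simp add: field_simps power2_eq_square)
qed

lemma quartic_strict_minimum:
  fixes v x :: "'a::real_inner"
  assumes "c\<^sub>1 \<ge> 0" "c\<^sub>2 > 0" "x \<noteq> r *\<^sub>R v"
    and root: "c\<^sub>1 * (norm v)\<^sup>2 * r ^ 3 + c\<^sub>2 * r - 1 = 0"
  shows "c\<^sub>1 * ((norm (r *\<^sub>R v))\<^sup>2 / 2)\<^sup>2 + c\<^sub>2 * ((norm (r *\<^sub>R v))\<^sup>2 / 2) - v \<bullet> (r *\<^sub>R v)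
       < c\<^sub>1 * ((norm x)\<^sup>2 / 2)\<^sup>2 + c\<^sub>2 * ((norm x)\<^sup>2 / 2) - v \<bullet> x"
proof -
  let ?y = "r *\<^sub>R v"
  have "(c\<^sub>1 * (norm ?y)\<^sup>2 + c\<^sub>2) * r = 1"
    using root by (simp add: power_mult_distrib power2_eq_square power3_eq_cube algebra_simps)
  then have crit: "v = (c\<^sub>1 * (norm ?y)\<^sup>2 + c\<^sub>2) *\<^sub>R ?y"
    by simp
  have "0 \<le> c\<^sub>1 / 4 * ((norm x)\<^sup>2 - (norm ?y)\<^sup>2)\<^sup>2"
    using assms by simp
  moreover have "0 < (c\<^sub>1 * (norm ?y)\<^sup>2 + c\<^sub>2) / 2 * (norm (x - ?y))\<^sup>2"
    using assms by (intro mult_pos_pos divide_pos_pos add_nonneg_pos) auto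
  ultimately show ?thesis
    using quartic_excess_at_critical_point[OF crit, of x] by linarith
qed

lemma inner_matrix: "X \<bullet> Y = (\<Sum>i\<in>UNIV. \<Sum>j\<in>UNIV. X $ i $ j * Y $ i $ j)"
  for X Y :: "real^'n^'m"
  by (simp add: inner_vec_def)

lemma inner_le_inner_pos_part:
  fixes X B :: "real^'n^'m"
  assumes "\<And>i j. 0 \<le> X $ i $ j"
  shows "B \<bullet> X \<le> \<Pi>\<^sub>+ B \<bullet> X"
  unfolding inner_matrix pos_part_def
  by (intro sum_mono) (auto intro!: mult_right_mono assms)

text \<open>The positive and the negative part of a matrix have disjoint supports.\<close>

lemma inner_pos_part_self:
  fixes B :: "real^'n^'m"
  shows "B \<bullet> \<Pi>\<^sub>+ B = \<Pi>\<^sub>+ B \<bullet> \<Pi>\<^sub>+ B"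
  unfolding inner_matrix pos_part_def
  by (rule sum.cong[OF refl], rule sum.cong[OF refl]) (simp add: max_def)

lemma norm_l1_eq_inner_ones:
  fixes X :: "real^'n^'m"
  assumes "\<And>i j. 0 \<le> X $ i $ j"
  shows "norm_l1 X = outer 1 1 \<bullet> X"
  using assms
  by (simp add: norm_l1_def inner_matrix outer_def matrix_matrix_mult_def
      columnvector_def rowvector_def)

lemma bpg_objective_nonneg:
  fixes U :: "real^'k^'m" and Z :: "real^'n^'k"
  assumes "\<And>i j. 0 \<le> U $ i $ j" "\<And>i j. 0 \<le> Z $ i $ j"
  shows "bpg_objective lam (l1_nonneg_reg lam\<^sub>1) g (mf_kernel c\<^sub>1 c\<^sub>2) x (U, Z) =
    ereal (c\<^sub>1 * ((norm (U, Z))\<^sup>2 / 2)\<^sup>2 + c\<^sub>2 * ((norm (U, Z))\<^sup>2 / 2)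
      - (- (bpg_P lam g (mf_kernel c\<^sub>1 c\<^sub>2) x + (lam * lam\<^sub>1) *\<^sub>R outer 1 1),
         - (bpg_Q lam g (mf_kernel c\<^sub>1 c\<^sub>2) x + (lam * lam\<^sub>1) *\<^sub>R outer 1 1)) \<bullet> (U, Z))"
  using assms
  by (simp add: bpg_objective_def l1_nonneg_reg_def nonneg_indicator_def mf_kernel_def norm_Pair
      norm_l1_eq_inner_ones inner_add_left inner_diff_left algebra_simps)

lemma bpg_objective_infeasible:
  assumes "lam > 0" "\<not> ((\<forall>i j. 0 \<le> U $ i $ j) \<and> (\<forall>i j. 0 \<le> Z $ i $ j))"
  shows "bpg_objective lam (l1_nonneg_reg lam\<^sub>1) g h x (U, Z) = \<infinity>"
  using assms
  by (auto simp: bpg_objective_def l1_nonneg_reg_def nonneg_indicator_def)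

lemma bpg_mf_update_eqI:
  assumes "\<And>x. x \<noteq> y \<Longrightarrow> bpg_objective lam f g h x\<^sub>0 y < bpg_objective lam f g h x\<^sub>0 x"
  shows "bpg_mf_update lam f g h x\<^sub>0 = {y}"
proof -
  have "is_arg_min (bpg_objective lam f g h x\<^sub>0) (\<lambda>_. True) x \<longleftrightarrow> x = y" for x
    unfolding is_arg_min_def using assms by (metis less_asym)
  then show ?thesis
    by (simp add: bpg_mf_update_def)
qed

theorem propositionD3:
  fixes A :: "real^'n^'m"
    and Uk :: "real^'k^'m" and Zk :: "real^'n^'k"
    and lam lam\<^sub>1 c\<^sub>1 c\<^sub>2 t\<^sub>0 :: real
    and f :: "(real^'k^'m) \<times> (real^'n^'k) \<Rightarrow> ereal"
    and g h :: "(real^'k^'m) \<times> (real^'n^'k) \<Rightarrow> real"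
    and P :: "real^'k^'m" and Q :: "real^'n^'k"
    and V :: "real^'k^'m" and W :: "real^'n^'k"
  assumes "A \<noteq> 0" and "lam > 0" and "lam\<^sub>1 > 0"
    and "c\<^sub>1 = 3" and "c\<^sub>2 = norm A" and "t\<^sub>0 = lam * lam\<^sub>1"
    and "g = mf_loss A"
    and "f = l1_nonneg_reg lam\<^sub>1"
    and "h = mf_kernel c\<^sub>1 c\<^sub>2"
    and "P = bpg_P lam g h (Uk, Zk)"
    and "Q = bpg_Q lam g h (Uk, Zk)"
    and "V = \<Pi>\<^sub>+ (- (P + t\<^sub>0 *\<^sub>R outer 1 1))"
    and "W = \<Pi>\<^sub>+ (- (Q + t\<^sub>0 *\<^sub>R outer 1 1))"
  shows "(\<exists>r\<ge>0. c\<^sub>1 * ((norm V)\<^sup>2 + (norm W)\<^sup>2) * r ^ 3 + c\<^sub>2 * r - 1 = 0) \<and>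
         (\<forall>r\<ge>0. c\<^sub>1 * ((norm V)\<^sup>2 + (norm W)\<^sup>2) * r ^ 3 + c\<^sub>2 * r - 1 = 0 \<longrightarrow>
            bpg_mf_update lam f g h (Uk, Zk) = {(r *\<^sub>R V, r *\<^sub>R W)})"
proof (intro conjI allI impI)
  have c: "c\<^sub>1 \<ge> 0" "c\<^sub>2 > 0"
    using assms by auto
  then show "\<exists>r\<ge>0. c\<^sub>1 * ((norm V)\<^sup>2 + (norm W)\<^sup>2) * r ^ 3 + c\<^sub>2 * r - 1 = 0"
    by (intro cubic_has_nonneg_root) auto
  fix r :: real
  assume r: "r \<ge> 0" and root: "c\<^sub>1 * ((norm V)\<^sup>2 + (norm W)\<^sup>2) * r ^ 3 + c\<^sub>2 * r - 1 = 0"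
  let ?obj = "bpg_objective lam f g h (Uk, Zk)"
  let ?q = "\<lambda>x. c\<^sub>1 * ((norm x)\<^sup>2 / 2)\<^sup>2 + c\<^sub>2 * ((norm x)\<^sup>2 / 2)"
  define b where "b = (- (P + t\<^sub>0 *\<^sub>R outer 1 1), - (Q + t\<^sub>0 *\<^sub>R outer 1 1))"
  let ?v = "(V, W)"
  let ?y = "r *\<^sub>R ?v"
  have VW: "V = \<Pi>\<^sub>+ (fst b)" "W = \<Pi>\<^sub>+ (snd b)"
    using assms by (simp_all add: b_def)
  have obj_nonneg: "?obj (U, Z) = ereal (?q (U, Z) - b \<bullet> (U, Z))"
    if "\<And>i j. 0 \<le> U $ i $ j" "\<And>i j. 0 \<le> Z $ i $ j" for U Z
    using bpg_objective_nonneg[OF that] assms unfolding b_def by simp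
  have "?obj ?y < ?obj x" if "x \<noteq> ?y" for x
  proof -
    obtain U Z where x: "x = (U, Z)"
      by fastforce
    have y: "?obj ?y = ereal (?q ?y - ?v \<bullet> ?y)"
    proof -
      have "?obj ?y = ereal (?q ?y - b \<bullet> ?y)"
        using obj_nonneg[of "r *\<^sub>R V" "r *\<^sub>R W"] r by (simp add: VW pos_part_def)
      moreover have "b \<bullet> ?v = ?v \<bullet> ?v"
        by (simp add: VW inner_prod_def inner_pos_part_self)
      ultimately show ?thesis
        by (metis inner_scaleR_right)
    qed
    show ?thesis
    proof (cases "(\<forall>i j. 0 \<le> U $ i $ j) \<and> (\<forall>i j. 0 \<le> Z $ i $ j)")
      case True
      have "?q ?y - ?v \<bullet> ?y < ?q x - ?v \<bullet> x"
        using c that root by (intro quartic_strict_minimum) (simp_all add: norm_Pair)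
      also have "\<dots> \<le> ?q x - b \<bullet> x"
        using True inner_le_inner_pos_part[of U "fst b"] inner_le_inner_pos_part[of Z "snd b"]
        by (simp add: x VW inner_prod_def)
      finally show ?thesis
        using True obj_nonneg[of U Z] y by (simp add: x)
    next
      case False
      then have "?obj x = \<infinity>"
        using bpg_objective_infeasible[OF \<open>lam > 0\<close> False] assms by (simp add: x)
      then show ?thesis
        using y by simp
    qed
  qed
  then have "bpg_mf_update lam f g h (Uk, Zk) = {?y}"
    by (rule bpg_mf_update_eqI)
  then show "bpg_mf_update lam f g h (Uk, Zk) = {(r *\<^sub>R V, r *\<^sub>R W)}"
    by simp
qed

end
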